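(* Let $h:\mathbb{R}^n\to\overline{\mathbb{R}}$ be a proper, lower semicontinuous and $\kappa$-quasar-convex function ($\kappa\in(0,1]$) with respect to every element of $\arg\min_{\mathbb{R}^n}h$. Suppose that $0<\beta'\le\beta_k\le\beta''$ for all $k\in\mathbb{N}_0$. Let $\{x^k\}_{k\in\mathbb{N}_0}$ be generated by HiPPA with parameter $p>1$, and assume that $x^k\to\overline{x}\in\arg\min_{\mathbb{R}^n}h$. Then the following assertions hold: (a) If $p\in(1,2)$, then for every $k\in\mathbb{N}$ (i.e. $k\ge 1$), $$h(x^k)-h(\overline{x})\le\frac{\|x^0-\overline{x}\|^p}{2^{p-1}\beta'\kappa}\,\frac{1}{k^{p-1}}.$$ (b) If $p=2$, then for every $k\in\mathbb{N}$, $$h(x^k)-h(\overline{x})\le\frac{\|x^0-\overline{x}\|^2}{2\kappa\beta'}\,\frac{1}{k}.$$ (c) If $p>2$, then for every $k\in\mathbb{N}$, $$h(x^k)-h(\overline{x})\le\frac{1}{\beta'\kappa p}\left(\frac{p-2}{p}\right)^{\frac{p-2}{2}}\frac{\|x^0-\overline{x}\|^p}{k^{p/2}}.$$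
   Context: $\overline{\mathbb{R}}=\mathbb{R}\cup\{+\infty\}$; $\mathrm{dom}(h)=\{x:h(x)<+\infty\}$; $h$ is proper if $\mathrm{dom}(h)\neq\emptyset$; $\|\cdot\|$ is the Euclidean norm; $\mathbb{N}_0=\mathbb{N}\cup\{0\}$. Let $\kappa\in(0,1]$. A proper function $h:\mathbb{R}^n\to\overline{\mathbb{R}}$ with convex domain and $\arg\min_{\mathbb{R}^n}h\neq\emptyset$ is called $\kappa$-quasar-convex with respect to $\overline{x}\in\arg\min_{\mathbb{R}^n}h$ if for all $x\in\mathrm{dom}(h)$ and all $\lambda\in[0,1]$, $$h(\lambda\overline{x}+(1-\lambda)x)\le\kappa\lambda h(\overline{x})+(1-\kappa\lambda)h(x).$$ For $p>1$, $\beta>0$: $\mathrm{Prox}^p_{\beta h}(x):=\arg\min_{y\in\mathbb{R}^n}\{h(y)+\frac{1}{p\beta}\|x-y\|^p\}$ (set-valued). HiPPA (high-order proximal-point algorithm): given $x^0\in\mathbb{R}^n$, $p>1$ and parameters $\{\beta_k\}_{k\in\mathbb{N}_0}\subseteq(0,+\infty)$, at iteration $k=0,1,2,\dots$ choose $x^{k+1}\in\mathrm{Prox}^p_{\beta_kh}(x^k)$; if $x^{k+1}=x^k$ stop, otherwise continue with $k+1$ (so an infinite generated sequence has $x^{k+1}\ne x^k$ for all $k$). *)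

theory Defs
  imports "HOL-Analysis.Analysis"
begin

(* Functions into the reals extended by +infinity are ereal-valued functions that
   avoid the value -infinity; this restriction is made part of proper. *)

definition edom :: "('a \<Rightarrow> ereal) \<Rightarrow> 'a set" where
  "edom h = {x. h x < \<infinity>}"

definition proper :: "('a \<Rightarrow> ereal) \<Rightarrow> bool" where
  "proper h \<longleftrightarrow> (\<forall>x. h x \<noteq> -\<infinity>) \<and> edom h \<noteq> {}"

definition argmin :: "('a \<Rightarrow> ereal) \<Rightarrow> 'a set" where
  "argmin h = {x. is_arg_min h (\<lambda>_. True) x}"

definition lower_semicontinuous :: "('a::topological_space \<Rightarrow> ereal) \<Rightarrow> bool" where
  "lower_semicontinuous h \<longleftrightarrow> (\<forall>x. h x \<le> Liminf (at x) h)"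

definition quasar_convex :: "real \<Rightarrow> ('a::real_vector \<Rightarrow> ereal) \<Rightarrow> 'a \<Rightarrow> bool" where
  "quasar_convex \<kappa> h z \<longleftrightarrow>
     proper h \<and> convex (edom h) \<and> z \<in> argmin h \<and>
     (\<forall>x\<in>edom h. \<forall>t\<in>{0..1}.
        h (t *\<^sub>R z + (1 - t) *\<^sub>R x) \<le> ereal (\<kappa> * t) * h z + ereal (1 - \<kappa> * t) * h x)"

definition prox :: "real \<Rightarrow> real \<Rightarrow> ('a::real_normed_vector \<Rightarrow> ereal) \<Rightarrow> 'a \<Rightarrow> 'a set" where
  "prox p \<beta> h x = argmin (\<lambda>y. h y + ereal (1 / (p * \<beta>) * norm (x - y) powr p))"

(* An infinite run of the high-order proximal-point algorithm: the stopping test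
   "x (k+1) = x k" never succeeds. *)
definition hippa_sequence ::
  "real \<Rightarrow> (nat \<Rightarrow> real) \<Rightarrow> ('a::real_normed_vector \<Rightarrow> ereal) \<Rightarrow> (nat \<Rightarrow> 'a) \<Rightarrow> bool" where
  "hippa_sequence p \<beta> h x \<longleftrightarrow>
     (\<forall>k. x (Suc k) \<in> prox p (\<beta> k) h (x k) \<and> x (Suc k) \<noteq> x k)"

end

theory Submission
  imports Defs
begin

text \<open>
  Write \<open>z\<close> for the minimiser \<open>xbar\<close>, \<open>v\<^sub>j = x\<^sub>j - x\<^sub>j\<^sub>+\<^sub>1\<close> and
  \<open>w\<^sub>j = x\<^sub>j\<^sub>+\<^sub>1 - z\<close>. Comparing the proximal objective at its minimiser \<open>x\<^sub>j\<^sub>+\<^sub>1\<close>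
  with its value at \<open>x\<^sub>j\<^sub>+\<^sub>1 + t(z - x\<^sub>j\<^sub>+\<^sub>1)\<close>, bounding \<open>h\<close> there by quasar-convexity, and
  letting \<open>t\<close> decrease to \<open>0\<close> gives
  \<open>\<kappa>\<beta>\<^sub>j(h(x\<^sub>j\<^sub>+\<^sub>1) - h(z)) \<le> \<parallel>v\<^sub>j\<parallel>\<^sup>p\<^sup>-\<^sup>2\<langle>v\<^sub>j,w\<^sub>j\<rangle>\<close> (lemma \<open>prox_quasar_convex_inner\<close>).
  The values \<open>h(x\<^sub>j)\<close> decrease from \<open>j = 1\<close> on, so for fixed \<open>k\<close> the number
  \<open>a = \<kappa>\<beta>'(h(x\<^sub>k) - h(z))\<close> is a lower bound for all these right-hand sides with \<open>j < k\<close>.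

  It remains to turn \<open>a \<le> \<parallel>v\<parallel>\<^sup>p\<^sup>-\<^sup>2\<langle>v,w\<rangle>\<close> into a lower bound for the decrease of a power of the
  distance to \<open>z\<close>, since \<open>\<parallel>v\<^sub>j + w\<^sub>j\<parallel>\<close> and \<open>\<parallel>w\<^sub>j\<parallel>\<close> are two consecutive distances; summing over
  \<open>j < k\<close> then telescopes. For \<open>p \<ge> 2\<close> the squared distance is used: if \<open>p = 2\<close> this is the expansion
  of the square, and if \<open>p > 2\<close> it is a weighted arithmetic-geometric mean inequality between
  \<open>\<parallel>v\<parallel>\<^sup>2\<close> and \<open>2\<langle>v,w\<rangle>\<close>, whose sum is the decrease. For \<open>p < 2\<close> the distance is
  raised to the conjugate exponent \<open>q = p/(p - 1) > 2\<close>: by Cauchy-Schwarz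
  \<open>\<parallel>v + w\<parallel>\<^sup>q - \<parallel>w\<parallel>\<^sup>q \<ge> 2\<langle>v,w\<rangle>\<parallel>w\<parallel>\<^sup>q\<^sup>-\<^sup>2 \<ge> 2\<langle>v,w\<rangle>(\<langle>v,w\<rangle>/\<parallel>v\<parallel>)\<^sup>q\<^sup>-\<^sup>2 \<ge> 2a\<^sup>q\<^sup>-\<^sup>1\<close>.
\<close>

section \<open>The optimality condition of a proximal step\<close>

lemma argmin_iff: "x \<in> argmin f \<longleftrightarrow> (\<forall>y. f x \<le> f y)"
  by (auto simp: argmin_def is_arg_min_def not_less)

lemma proper_edom_eq_ereal:
  assumes "proper h" "y \<in> edom h"
  shows "h y = ereal (real_of_ereal (h y))"
  using assms by (cases "h y") (auto simp: proper_def edom_def)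

lemma argmin_imp_edom:
  assumes "proper h" "z \<in> argmin h"
  shows "z \<in> edom h"
proof -
  obtain u where "h u < \<infinity>"
    using assms(1) by (auto simp: proper_def edom_def)
  moreover have "h z \<le> h u"
    using assms(2) by (simp add: argmin_iff)
  ultimately show ?thesis
    unfolding edom_def mem_Collect_eq by (rule le_less_trans[rotated])
qed

lemma prox_imp_edom:
  assumes "proper h" "y \<in> prox p b h x"
  shows "y \<in> edom h"
proof -
  obtain u where u: "u \<in> edom h"
    using assms(1) by (auto simp: proper_def)
  have "h y + ereal (1 / (p * b) * norm (x - y) powr p) \<le> h u + ereal (1 / (p * b) * norm (x - u) powr p)"
    using assms(2) by (simp add: prox_def argmin_iff)
  then show ?thesis
    using proper_edom_eq_ereal[OF assms(1) u] by (cases "h u"; cases "h y") (auto simp: edom_def)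
qed

lemma prox_le:
  assumes "proper h" "y \<in> prox p b h x" "u \<in> edom h"
  shows "real_of_ereal (h y) + 1 / (p * b) * norm (x - y) powr p
           \<le> real_of_ereal (h u) + 1 / (p * b) * norm (x - u) powr p"
proof -
  have "h y + ereal (1 / (p * b) * norm (x - y) powr p) \<le> h u + ereal (1 / (p * b) * norm (x - u) powr p)"
    using assms(2) by (simp add: prox_def argmin_iff)
  moreover obtain s where "h y = ereal s"
    using proper_edom_eq_ereal[OF assms(1) prox_imp_edom[OF assms(1,2)]] by blast
  moreover obtain t where "h u = ereal t"
    using proper_edom_eq_ereal[OF assms(1,3)] by blast
  ultimately show ?thesis
    by simp
qed

lemma prox_value_le:
  assumes "proper h" "y \<in> prox p b h x" "x \<in> edom h" "0 < p" "0 < b"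
  shows "real_of_ereal (h y) \<le> real_of_ereal (h x)"
proof -
  have "0 \<le> 1 / (p * b) * norm (x - y) powr p"
    using assms by simp
  then show ?thesis
    using prox_le[OF assms(1-3)] by simp
qed

lemma quasar_convex_segment:
  assumes "quasar_convex \<kappa> h z" "y \<in> edom h" "0 \<le> t" "t \<le> 1"
  shows "t *\<^sub>R z + (1 - t) *\<^sub>R y \<in> edom h"
    and "real_of_ereal (h (t *\<^sub>R z + (1 - t) *\<^sub>R y))
           \<le> real_of_ereal (h y) - \<kappa> * t * (real_of_ereal (h y) - real_of_ereal (h z))"
proof -
  let ?u = "t *\<^sub>R z + (1 - t) *\<^sub>R y"
  have h: "proper h" and z: "z \<in> argmin h" and cvx: "convex (edom h)"
    using assms(1) by (auto simp: quasar_convex_def)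
  have zd: "z \<in> edom h"
    by (rule argmin_imp_edom[OF h z])
  show ud: "?u \<in> edom h"
    using convexD[OF cvx zd assms(2), of t "1 - t"] assms by simp
  have le: "h ?u \<le> ereal (\<kappa> * t) * h z + ereal (1 - \<kappa> * t) * h y"
    using assms by (auto simp: quasar_convex_def)
  obtain a where a: "h z = ereal a"
    using proper_edom_eq_ereal[OF h zd] by blast
  obtain b where b: "h y = ereal b"
    using proper_edom_eq_ereal[OF h assms(2)] by blast
  obtain c where c: "h ?u = ereal c"
    using proper_edom_eq_ereal[OF h ud] by blast
  have "c \<le> \<kappa> * t * a + (1 - \<kappa> * t) * b"
    using le by (simp add: a b c)
  then show "real_of_ereal (h ?u)
      \<le> real_of_ereal (h y) - \<kappa> * t * (real_of_ereal (h y) - real_of_ereal (h z))"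
    unfolding a b c real_of_ereal.simps by (simp add: algebra_simps)
qed

lemma has_real_derivative_norm_powr_line:
  fixes v w :: "'a::real_inner"
  assumes "v \<noteq> 0"
  shows "((\<lambda>t. norm (v + t *\<^sub>R w) powr p) has_real_derivative p * (norm v powr (p - 2) * (v \<bullet> w))) (at 0)"
proof -
  have sq: "norm (v + t *\<^sub>R w) powr p = (v \<bullet> v + 2 * t * (v \<bullet> w) + t\<^sup>2 * (w \<bullet> w)) powr (p / 2)" for t
  proof -
    have "norm (v + t *\<^sub>R w) powr p = ((norm (v + t *\<^sub>R w)) powr 2) powr (p / 2)"
      by (simp only: powr_powr) simp
    also have "(norm (v + t *\<^sub>R w)) powr 2 = (v + t *\<^sub>R w) \<bullet> (v + t *\<^sub>R w)"
      by (simp add: power2_norm_eq_inner)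
    also have "\<dots> = v \<bullet> v + 2 * t * (v \<bullet> w) + t\<^sup>2 * (w \<bullet> w)"
      by (simp add: inner_add_left inner_add_right inner_commute power2_eq_square algebra_simps)
    finally show ?thesis .
  qed
  have pos: "0 < v \<bullet> v"
    using assms by simp
  have "((\<lambda>t. (v \<bullet> v + 2 * t * (v \<bullet> w) + t\<^sup>2 * (w \<bullet> w)) powr (p / 2)) has_real_derivative
          (p / 2) * (v \<bullet> v) powr (p / 2 - 1) * (2 * (v \<bullet> w))) (at 0)"
    using pos by (auto intro!: derivative_eq_intros)
  moreover have "(v \<bullet> v) powr (p / 2 - 1) = norm v powr (p - 2)"
  proof -
    have "(v \<bullet> v) powr (p / 2 - 1) = (norm v powr 2) powr (p / 2 - 1)"
      by (simp add: power2_norm_eq_inner)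
    also have "\<dots> = norm v powr (p - 2)"
      by (simp only: powr_powr) (simp add: algebra_simps)
    finally show ?thesis .
  qed
  ultimately show ?thesis
    by (simp add: sq mult_ac)
qed

lemma derivative_ge_of_right_growth:
  fixes f :: "real \<Rightarrow> real"
  assumes "(f has_real_derivative d) (at 0)"
    and "\<And>t. 0 < t \<Longrightarrow> t \<le> 1 \<Longrightarrow> c * t \<le> f t - f 0"
  shows "c \<le> d"
proof (rule tendsto_lowerbound)
  show "((\<lambda>t. (f t - f 0) / (t - 0)) \<longlongrightarrow> d) (at_right 0)"
    using assms(1) by (auto simp: has_field_derivative_iff intro: tendsto_within_subset)
  show "\<forall>\<^sub>F t in at_right 0. c \<le> (f t - f 0) / (t - 0)"
    using eventually_at_right_real[OF zero_less_one]
  proof eventually_elim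
    case (elim t)
    then show ?case
      using assms(2)[of t] by (simp add: field_simps)
  qed
qed simp

text \<open>
  First-order optimality of the proximal point, tested in the direction of \<open>z\<close>: the function \<open>h\<close> need
  not be differentiable, because quasar-convexity guarantees at least a linear decrease of
  \<open>h\<close> on the segment towards \<open>z\<close>.
\<close>

lemma prox_quasar_convex_inner:
  fixes x y z :: "'a::real_inner"
  assumes qc: "quasar_convex \<kappa> h z" and y: "y \<in> prox p b h x" and "y \<noteq> x" and "0 < p" and "0 < b"
  shows "\<kappa> * b * (real_of_ereal (h y) - real_of_ereal (h z))
           \<le> norm (x - y) powr (p - 2) * ((x - y) \<bullet> (y - z))"
proof -
  have h: "proper h"
    using qc by (simp add: quasar_convex_def)
  define \<delta> where "\<delta> = real_of_ereal (h y) - real_of_ereal (h z)"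
  have "p * b * \<kappa> * \<delta> * t \<le> norm ((x - y) + t *\<^sub>R (y - z)) powr p - norm ((x - y) + 0 *\<^sub>R (y - z)) powr p"
    if t: "0 < t" "t \<le> 1" for t
  proof -
    let ?u = "t *\<^sub>R z + (1 - t) *\<^sub>R y"
    have yd: "y \<in> edom h"
      by (rule prox_imp_edom[OF h y])
    note seg = quasar_convex_segment[OF qc yd, of t]
    have u: "x - ?u = (x - y) + t *\<^sub>R (y - z)"
      by (simp add: algebra_simps)
    have "real_of_ereal (h y) + 1 / (p * b) * norm (x - y) powr p
        \<le> real_of_ereal (h ?u) + 1 / (p * b) * norm ((x - y) + t *\<^sub>R (y - z)) powr p"
      using prox_le[OF h y seg(1)] t unfolding u by simp
    then have "\<kappa> * t * \<delta> \<le> (norm ((x - y) + t *\<^sub>R (y - z)) powr p - norm (x - y) powr p) / (p * b)"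
      using seg(2) t by (simp add: \<delta>_def diff_divide_distrib)
    then show ?thesis
      using assms(4,5) by (simp add: field_simps)
  qed
  \<comment> \<open>The derivative at \<open>0\<close> exists because \<open>x - y \<noteq> 0\<close>.\<close>
  then have "p * b * \<kappa> * \<delta> \<le> p * (norm (x - y) powr (p - 2) * ((x - y) \<bullet> (y - z)))"
    using derivative_ge_of_right_growth[OF has_real_derivative_norm_powr_line] assms(3)
    by (metis (no_types, lifting) right_minus_eq)
  then have "p * (\<kappa> * b * \<delta>) \<le> p * (norm (x - y) powr (p - 2) * ((x - y) \<bullet> (y - z)))"
    by (simp add: mult_ac)
  then show ?thesis
    using \<open>0 < p\<close> by (simp add: \<delta>_def)
qed

section \<open>Decrease of the distance in one step\<close>

lemma norm_add_square:
  fixes v w :: "'a::real_inner"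
  shows "(norm (v + w))\<^sup>2 = (norm v)\<^sup>2 + 2 * (v \<bullet> w) + (norm w)\<^sup>2"
  by (simp add: power2_norm_eq_inner inner_add_left inner_add_right inner_commute)

lemma norm_conjugate_powr_decrease:
  fixes v w :: "'a::real_inner"
  assumes "1 < p" "p < 2" "v \<noteq> 0" "0 \<le> a" "a \<le> norm v powr (p - 2) * (v \<bullet> w)"
  shows "2 * a powr (1 / (p - 1)) \<le> norm (v + w) powr (p / (p - 1)) - norm w powr (p / (p - 1))"
proof -
  define q where "q = p / (p - 1)"
  have q: "2 < q" and q1: "1 / (p - 1) = q - 1" and qp: "(p - 2) * (q - 1) = 2 - q"
    using assms by (auto simp: q_def field_simps)
  \<comment> \<open>The component of \<open>w\<close> along \<open>v\<close>, which lies between \<open>0\<close> and \<open>norm w\<close>.\<close>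
  define c where "c = (v \<bullet> w) / norm v"
  have nv: "0 < norm v"
    using assms by simp
  have "0 \<le> norm v powr (p - 2) * (v \<bullet> w)"
    using assms by linarith
  then have vw: "0 \<le> v \<bullet> w"
    using nv by (simp add: zero_le_mult_iff)
  then have c: "0 \<le> c"
    by (simp add: c_def)
  have cw: "c \<le> norm w"
    using nv Cauchy_Schwarz_ineq2[of v w] by (simp add: c_def field_simps)
  have "norm w \<le> norm (v + w)"
  proof (rule power2_le_imp_le)
    show "(norm w)\<^sup>2 \<le> (norm (v + w))\<^sup>2"
      using vw by (simp add: norm_add_square)
  qed simp
  then have "norm w powr (q - 2) * (norm (v + w))\<^sup>2 \<le> norm (v + w) powr (q - 2) * (norm (v + w))\<^sup>2"
    using q by (intro mult_right_mono powr_mono2) auto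
  moreover have split: "s powr (q - 2) * s\<^sup>2 = s powr q" if "0 \<le> s" for s :: real
    using that by (cases "s = 0") (auto simp: powr_diff)
  ultimately have "norm w powr (q - 2) * ((norm (v + w))\<^sup>2 - (norm w)\<^sup>2)
      \<le> norm (v + w) powr q - norm w powr q"
    by (simp add: right_diff_distrib)
  moreover have "c powr (q - 2) * (2 * (v \<bullet> w)) \<le> norm w powr (q - 2) * ((norm (v + w))\<^sup>2 - (norm w)\<^sup>2)"
    using c cw q vw by (intro mult_mono powr_mono2) (auto simp: norm_add_square)
  moreover have "a powr (q - 1) \<le> c powr (q - 2) * (v \<bullet> w)"
  proof -
    have "a powr (q - 1) \<le> (norm v powr (p - 2) * (v \<bullet> w)) powr (q - 1)"
      using assms q by (intro powr_mono2) auto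
    also have "\<dots> = norm v powr (2 - q) * (v \<bullet> w) powr (q - 1)"
      using vw by (simp add: powr_mult powr_powr qp)
    also have "\<dots> = c powr (q - 2) * (v \<bullet> w)"
      using vw nv q by (cases "v \<bullet> w = 0") (auto simp: c_def powr_divide powr_diff field_simps power2_eq_square)
    finally show ?thesis .
  qed
  ultimately show ?thesis
    unfolding q1 q_def[symmetric] by linarith
qed

lemma norm_square_decrease_powr:
  fixes v w :: "'a::real_inner"
  assumes "2 < p" "v \<noteq> 0" "0 \<le> a" "a \<le> norm v powr (p - 2) * (v \<bullet> w)"
  shows "(p * a / ((p - 2) / p) powr ((p - 2) / 2)) powr (2 / p) \<le> (norm (v + w))\<^sup>2 - (norm w)\<^sup>2"
proof -
  \<comment> \<open>The weights \<open>\<theta>\<close> and \<open>2 / p\<close> of the arithmetic-geometric mean inequality sum to \<open>1\<close>.\<close>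
  define \<theta> where "\<theta> = (p - 2) / p"
  have \<theta>: "0 < \<theta>" "\<theta> + 2 / p = 1" and \<theta>p: "(p - 2) / 2 * (2 / p) = \<theta>"
    using assms by (auto simp: \<theta>_def field_simps)
  have nv: "0 < norm v"
    using assms by simp
  have "0 \<le> norm v powr (p - 2) * (v \<bullet> w)"
    using assms by linarith
  then have vw: "0 \<le> v \<bullet> w"
    using nv by (simp add: zero_le_mult_iff)
  have sq: "norm v powr (p - 2) = ((norm v)\<^sup>2) powr ((p - 2) / 2)"
  proof -
    have "((norm v)\<^sup>2) powr ((p - 2) / 2) = (norm v powr 2) powr ((p - 2) / 2)"
      by simp
    also have "\<dots> = norm v powr (p - 2)"
      by (simp only: powr_powr) (simp add: diff_divide_distrib)
    finally show ?thesis by simp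
  qed
  have "p * a / \<theta> powr ((p - 2) / 2) \<le> p * (norm v powr (p - 2) * (v \<bullet> w)) / \<theta> powr ((p - 2) / 2)"
    using assms by (intro divide_right_mono mult_left_mono) auto
  also have "\<dots> = ((norm v)\<^sup>2 / \<theta>) powr ((p - 2) / 2) * (p * (v \<bullet> w))"
    using \<theta> by (simp add: sq powr_divide)
  finally have "(p * a / \<theta> powr ((p - 2) / 2)) powr (2 / p)
      \<le> (((norm v)\<^sup>2 / \<theta>) powr ((p - 2) / 2) * (p * (v \<bullet> w))) powr (2 / p)"
    using assms by (intro powr_mono2) auto
  also have "\<dots> = ((norm v)\<^sup>2 / \<theta>) powr \<theta> * (p * (v \<bullet> w)) powr (2 / p)"
    using vw assms \<theta> by (simp only: powr_mult powr_powr \<theta>p)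
  also have "\<dots> \<le> \<theta> * ((norm v)\<^sup>2 / \<theta>) + (2 / p) * (p * (v \<bullet> w))"
  proof (cases "v \<bullet> w = 0")
    case False
    then show ?thesis
      using vw nv assms \<theta> by (intro Youngs_inequality_0) auto
  qed (use \<theta> in simp)
  also have "\<dots> = (norm (v + w))\<^sup>2 - (norm w)\<^sup>2"
    using \<theta> assms by (simp add: norm_add_square)
  finally show ?thesis
    by (simp add: \<theta>_def)
qed

section \<open>Rates obtained by telescoping\<close>

lemma telescope_lower_bound:
  fixes e :: "nat \<Rightarrow> real"
  assumes "\<And>j. j < k \<Longrightarrow> c \<le> e j - e (Suc j)" "0 \<le> e k"
  shows "real k * c \<le> e 0"
proof -
  have "real k * c = (\<Sum>j<k. c)"
    by simp
  also have "\<dots> \<le> (\<Sum>j<k. e j - e (Suc j))"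
    using assms(1) by (intro sum_mono) auto
  also have "\<dots> = e 0 - e k"
    by (rule sum_lessThan_telescope')
  finally show ?thesis
    using assms(2) by linarith
qed

lemma rate_lt_2:
  fixes x :: "nat \<Rightarrow> 'a::real_inner"
  assumes "1 < p" "p < 2" "1 \<le> k" "0 \<le> a"
    and "\<And>j. j < k \<Longrightarrow> x (Suc j) \<noteq> x j"
    and "\<And>j. j < k \<Longrightarrow> a \<le> norm (x j - x (Suc j)) powr (p - 2) * ((x j - x (Suc j)) \<bullet> (x (Suc j) - z))"
  shows "a \<le> norm (x 0 - z) powr p / 2 powr (p - 1) * (1 / real k powr (p - 1))"
proof -
  have "real k * (2 * a powr (1 / (p - 1))) \<le> norm (x 0 - z) powr (p / (p - 1))"
  proof (rule telescope_lower_bound)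
    fix j assume "j < k"
    then show "2 * a powr (1 / (p - 1)) \<le> norm (x j - z) powr (p / (p - 1)) - norm (x (Suc j) - z) powr (p / (p - 1))"
      using norm_conjugate_powr_decrease[of p "x j - x (Suc j)" a "x (Suc j) - z"] assms by force
  qed simp
  then have "a powr (1 / (p - 1)) \<le> norm (x 0 - z) powr (p / (p - 1)) / (2 * real k)"
    using assms by (simp add: field_simps)
  then have "(a powr (1 / (p - 1))) powr (p - 1) \<le> (norm (x 0 - z) powr (p / (p - 1)) / (2 * real k)) powr (p - 1)"
    using assms by (intro powr_mono2) auto
  then show ?thesis
    using assms by (simp add: powr_powr powr_divide powr_mult)
qed

lemma rate_eq_2:
  fixes x :: "nat \<Rightarrow> 'a::real_inner"
  assumes "1 \<le> k"
    and "\<And>j. j < k \<Longrightarrow> a \<le> (x j - x (Suc j)) \<bullet> (x (Suc j) - z)"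
  shows "a \<le> (norm (x 0 - z))\<^sup>2 / 2 * (1 / real k)"
proof -
  have "real k * (2 * a) \<le> (norm (x 0 - z))\<^sup>2"
  proof (rule telescope_lower_bound)
    fix j assume "j < k"
    then show "2 * a \<le> (norm (x j - z))\<^sup>2 - (norm (x (Suc j) - z))\<^sup>2"
      using norm_add_square[of "x j - x (Suc j)" "x (Suc j) - z"] assms(2)[of j]
      by (simp add: add_increasing)
  qed simp
  then show ?thesis
    using assms(1) by (simp add: field_simps)
qed

lemma rate_gt_2:
  fixes x :: "nat \<Rightarrow> 'a::real_inner"
  assumes "2 < p" "1 \<le> k" "0 \<le> a"
    and "\<And>j. j < k \<Longrightarrow> x (Suc j) \<noteq> x j"
    and "\<And>j. j < k \<Longrightarrow> a \<le> norm (x j - x (Suc j)) powr (p - 2) * ((x j - x (Suc j)) \<bullet> (x (Suc j) - z))"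
  shows "a \<le> 1 / p * ((p - 2) / p) powr ((p - 2) / 2) * (norm (x 0 - z) powr p / real k powr (p / 2))"
proof -
  define m where "m = ((p - 2) / p) powr ((p - 2) / 2)"
  have m: "0 < m"
    using assms by (simp add: m_def)
  have "real k * (p * a / m) powr (2 / p) \<le> (norm (x 0 - z))\<^sup>2"
  proof (rule telescope_lower_bound)
    fix j assume "j < k"
    then show "(p * a / m) powr (2 / p) \<le> (norm (x j - z))\<^sup>2 - (norm (x (Suc j) - z))\<^sup>2"
      using norm_square_decrease_powr[of p "x j - x (Suc j)" a "x (Suc j) - z"] assms
      unfolding m_def by force
  qed simp
  then have "(p * a / m) powr (2 / p) \<le> norm (x 0 - z) powr 2 / real k"
    using assms by (simp add: field_simps)
  then have "((p * a / m) powr (2 / p)) powr (p / 2) \<le> (norm (x 0 - z) powr 2 / real k) powr (p / 2)"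
    using assms by (intro powr_mono2) auto
  moreover have "((p * a / m) powr (2 / p)) powr (p / 2) = p * a / m"
    using assms m by (simp add: powr_powr)
  moreover have "(norm (x 0 - z) powr 2 / real k) powr (p / 2) = norm (x 0 - z) powr p / real k powr (p / 2)"
    using assms by (simp add: powr_divide powr_powr del: powr_numeral)
  ultimately have "p * a / m \<le> norm (x 0 - z) powr p / real k powr (p / 2)"
    by simp
  then have "a \<le> 1 / p * m * (norm (x 0 - z) powr p / real k powr (p / 2))"
    using assms m by (simp add: field_simps)
  then show ?thesis
    unfolding m_def .
qed

section \<open>Convergence rate of the function values\<close>

text \<open>
  The left-hand side does not depend on \<open>j\<close>: by monotonicity the gap at step \<open>k\<close> stands in for the gap
  at every earlier step.
\<close>

lemma hippa_inner_lower_bound: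
  fixes x :: "nat \<Rightarrow> 'a::real_inner"
  assumes "0 < \<kappa>" "quasar_convex \<kappa> h z" "0 < \<beta>'" "\<And>k. \<beta>' \<le> \<beta> k" "0 < p"
    and hip: "hippa_sequence p \<beta> h x" and "j < k"
  shows "\<kappa> * \<beta>' * (real_of_ereal (h (x k)) - real_of_ereal (h z))
           \<le> norm (x j - x (Suc j)) powr (p - 2) * ((x j - x (Suc j)) \<bullet> (x (Suc j) - z))"
proof -
  have h: "proper h" and z: "z \<in> argmin h"
    using assms(2) by (auto simp: quasar_convex_def)
  have step: "x (Suc i) \<in> prox p (\<beta> i) h (x i)" "x (Suc i) \<noteq> x i" for i
    using hip by (auto simp: hippa_sequence_def)
  have \<beta>: "0 < \<beta> i" for i
    using assms(3) assms(4)[of i] by linarith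
  have dom: "x (Suc i) \<in> edom h" for i
    by (rule prox_imp_edom[OF h step(1)])
  \<comment> \<open>The index is shifted by one since \<open>h (x 0)\<close> may be infinite.\<close>
  define \<delta> where "\<delta> i = real_of_ereal (h (x (Suc i))) - real_of_ereal (h z)" for i
  have "antimono \<delta>"
    unfolding decseq_Suc_iff \<delta>_def
    using prox_value_le[OF h step(1) dom \<open>0 < p\<close> \<beta>] by simp
  moreover have "j \<le> k - 1"
    using assms(7) by simp
  ultimately have "\<delta> (k - 1) \<le> \<delta> j"
    by (rule antimonoD)
  moreover have "0 \<le> \<delta> j"
  proof -
    have "h z \<le> h (x (Suc j))"
      using z by (simp add: argmin_iff)
    then show ?thesis
      using proper_edom_eq_ereal[OF h dom[of j]] proper_edom_eq_ereal[OF h argmin_imp_edom[OF h z]]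
      unfolding \<delta>_def by (metis diff_ge_0_iff_ge ereal_less_eq(3))
  qed
  moreover have "\<delta> (k - 1) = real_of_ereal (h (x k)) - real_of_ereal (h z)"
    using assms(7) by (simp add: \<delta>_def)
  ultimately have "\<kappa> * \<beta>' * (real_of_ereal (h (x k)) - real_of_ereal (h z)) \<le> \<kappa> * \<beta> j * \<delta> j"
    using assms(1,3) assms(4)[of j] \<beta>[of j]
    by (smt (verit, best) mult_left_mono mult_right_mono mult_pos_pos)
  also have "\<dots> \<le> norm (x j - x (Suc j)) powr (p - 2) * ((x j - x (Suc j)) \<bullet> (x (Suc j) - z))"
    unfolding \<delta>_def by (rule prox_quasar_convex_inner[OF assms(2) step \<open>0 < p\<close> \<beta>])
  finally show ?thesis .
qed

theorem theorem50:
  fixes h :: "real ^ 'n \<Rightarrow> ereal"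
    and \<kappa> p \<beta>' \<beta>'' :: real
    and \<beta> :: "nat \<Rightarrow> real"
    and x :: "nat \<Rightarrow> real ^ 'n"
    and xbar :: "real ^ 'n"
  assumes "0 < \<kappa>" and "\<kappa> \<le> 1"
    and "proper h"
    and "lower_semicontinuous h"
    and "\<forall>z\<in>argmin h. quasar_convex \<kappa> h z"
    and "0 < \<beta>'" and "\<forall>k. \<beta>' \<le> \<beta> k \<and> \<beta> k \<le> \<beta>''"
    and "1 < p"
    and "hippa_sequence p \<beta> h x"
    and "xbar \<in> argmin h"
    and "x \<longlonglongrightarrow> xbar"
  shows "(p < 2 \<longrightarrow> (\<forall>k\<ge>1. h (x k) - h xbar \<le>
            ereal (norm (x 0 - xbar) powr p / (2 powr (p - 1) * \<beta>' * \<kappa>)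
                   * (1 / real k powr (p - 1)))))
       \<and> (p = 2 \<longrightarrow> (\<forall>k\<ge>1. h (x k) - h xbar \<le>
            ereal ((norm (x 0 - xbar))\<^sup>2 / (2 * \<kappa> * \<beta>') * (1 / real k))))
       \<and> (p > 2 \<longrightarrow> (\<forall>k\<ge>1. h (x k) - h xbar \<le>
            ereal (1 / (\<beta>' * \<kappa> * p) * ((p - 2) / p) powr ((p - 2) / 2)
                   * (norm (x 0 - xbar) powr p / real k powr (p / 2)))))"
proof -
  have qc: "quasar_convex \<kappa> h xbar"
    using assms by blast
  have pos: "0 < \<kappa> * \<beta>'" and "0 < p"
    using assms by auto
  have ne: "x (Suc j) \<noteq> x j" for j
    using assms(9) by (auto simp: hippa_sequence_def)
  define a where "a k = \<kappa> * \<beta>' * (real_of_ereal (h (x k)) - real_of_ereal (h xbar))" for k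
  have low: "a k \<le> norm (x j - x (Suc j)) powr (p - 2) * ((x j - x (Suc j)) \<bullet> (x (Suc j) - xbar))"
    if "j < k" for j k
    unfolding a_def
    by (rule hippa_inner_lower_bound[OF assms(1) qc assms(6) _ \<open>0 < p\<close> assms(9) that])
      (use assms(7) in blast)
  have xd: "\<exists>r. h (x k) = ereal r" if "1 \<le> k" for k
  proof -
    have "x (Suc (k - 1)) \<in> prox p (\<beta> (k - 1)) h (x (k - 1))"
      using assms(9) unfolding hippa_sequence_def by blast
    then have "x (Suc (k - 1)) \<in> edom h"
      by (rule prox_imp_edom[OF assms(3)])
    then have "x k \<in> edom h"
      using that by simp
    then show ?thesis
      using proper_edom_eq_ereal[OF assms(3)] by blast
  qed
  obtain m where m: "h xbar = ereal m"
    using proper_edom_eq_ereal[OF assms(3) argmin_imp_edom[OF assms(3,10)]] by blast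
  have a0: "0 \<le> a k" if k: "1 \<le> k" for k
  proof -
    obtain r where "h (x k) = ereal r"
      using xd[OF k] by blast
    moreover have "h xbar \<le> h (x k)"
      using assms(10) by (simp add: argmin_iff)
    ultimately show ?thesis
      using pos m by (simp add: a_def)
  qed
  have gap: "h (x k) - h xbar \<le> ereal B" if k: "1 \<le> k" and B: "a k \<le> \<kappa> * \<beta>' * B" for k B
  proof -
    obtain r where r: "h (x k) = ereal r"
      using xd[OF k] by blast
    have "\<kappa> * \<beta>' * (r - m) \<le> \<kappa> * \<beta>' * B"
      using B by (simp add: a_def r m)
    then have "r - m \<le> B"
      using pos by (simp only: mult_le_cancel_left_pos)
    then show ?thesis
      by (simp add: r m)
  qed
  show ?thesis
  proof (intro conjI impI allI)
    fix k :: nat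
    assume p: "p < 2" and k: "1 \<le> k"
    show "h (x k) - h xbar \<le> ereal (norm (x 0 - xbar) powr p / (2 powr (p - 1) * \<beta>' * \<kappa>)
            * (1 / real k powr (p - 1)))"
      using rate_lt_2[of p k "a k" x xbar, OF \<open>1 < p\<close> p k a0[OF k] ne low] assms(1,6)
      by (intro gap[OF k]) simp_all
  next
    fix k :: nat
    assume p: "p = 2" and k: "1 \<le> k"
    have "a k \<le> (x j - x (Suc j)) \<bullet> (x (Suc j) - xbar)" if "j < k" for j
      using low[OF that] ne[of j] by (simp add: p)
    then show "h (x k) - h xbar \<le> ereal ((norm (x 0 - xbar))\<^sup>2 / (2 * \<kappa> * \<beta>') * (1 / real k))"
      using rate_eq_2[of k "a k" x xbar, OF k] assms(1,6)
      by (intro gap[OF k]) simp_all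
  next
    fix k :: nat
    assume p: "2 < p" and k: "1 \<le> k"
    show "h (x k) - h xbar \<le> ereal (1 / (\<beta>' * \<kappa> * p) * ((p - 2) / p) powr ((p - 2) / 2)
            * (norm (x 0 - xbar) powr p / real k powr (p / 2)))"
      using rate_gt_2[of p k "a k" x xbar, OF p k a0[OF k] ne low] assms(1,6)
      by (intro gap[OF k]) simp_all
  qed
qed

end
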